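(* Let $M$ be a right cancellative finitely generated hyperbolic monoid. Then $M$ does not contain a submonoid isomorphic to $\mathbb{N}\times\mathbb{N}$.
   Context: For a monoid $M$ with finite generating set $A$, the (right) Cayley digraph has vertex set $M$ and a directed edge from $m$ to $ma$ for every $m\in M$, $a\in A$. For a digraph $D$, a directed path $x_0x_1\ldots x_n$ has edges $x_ix_{i+1}$ and length $n$; $d(x,y)$ is the length of a shortest directed $x$-$y$ path ($\infty$ if none), and such a shortest path is an $x$-$y$ geodesic. The out-ball $\mathcal{B}^+_k(x)$ is $\{y: d(x,y)\le k\}$, the in-ball $\mathcal{B}^-_k(x)$ is $\{y: d(y,x)\le k\}$; for a path $Q$, $\mathcal{B}^\pm_k(Q)$ is the union of the corresponding balls around its vertices. A geodesic triangle consists of three vertices and, for each pair of them, a geodesic between them (in one of the two directions); these are its sides. It is $\delta$-thin if whenever $P,Q,R$ are its sides such that the start vertex of $P$ is the start or end vertex of $Q$ and the end vertex of $P$ is the start or end vertex of $R$, then $P\subseteq \mathcal{B}^+_\delta(Q)\cup\mathcal{B}^-_\delta(R)$. A digraph is hyperbolic if for some $\delta\ge 0$ all its geodesic triangles are $\delta$-thin. A finitely generated monoid is hyperbolic if its Cayley digraph with respect to a finite generating set is hyperbolic. *)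

theory Defs
  imports Main "HOL-Library.Extended_Nat"
begin

definition dpath :: "('v \<Rightarrow> 'v \<Rightarrow> bool) \<Rightarrow> 'v list \<Rightarrow> bool" where
  "dpath E p \<longleftrightarrow> p \<noteq> [] \<and> (\<forall>i. Suc i < length p \<longrightarrow> E (p ! i) (p ! Suc i))"

definition dpath_from_to :: "('v \<Rightarrow> 'v \<Rightarrow> bool) \<Rightarrow> 'v \<Rightarrow> 'v \<Rightarrow> 'v list \<Rightarrow> bool" where
  "dpath_from_to E x y p \<longleftrightarrow> dpath E p \<and> hd p = x \<and> last p = y"

text \<open>Directed distance; infinity if there is no directed path.\<close>
definition ddist :: "('v \<Rightarrow> 'v \<Rightarrow> bool) \<Rightarrow> 'v \<Rightarrow> 'v \<Rightarrow> enat" where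
  "ddist E x y = (INF p \<in> {p. dpath_from_to E x y p}. enat (length p - 1))"

definition geodesic :: "('v \<Rightarrow> 'v \<Rightarrow> bool) \<Rightarrow> 'v \<Rightarrow> 'v \<Rightarrow> 'v list \<Rightarrow> bool" where
  "geodesic E x y p \<longleftrightarrow> dpath_from_to E x y p \<and> enat (length p - 1) = ddist E x y"

definition out_ball :: "('v \<Rightarrow> 'v \<Rightarrow> bool) \<Rightarrow> nat \<Rightarrow> 'v \<Rightarrow> 'v set" where
  "out_ball E k x = {y. ddist E x y \<le> enat k}"

definition in_ball :: "('v \<Rightarrow> 'v \<Rightarrow> bool) \<Rightarrow> nat \<Rightarrow> 'v \<Rightarrow> 'v set" where
  "in_ball E k x = {y. ddist E y x \<le> enat k}"

definition out_ball_path :: "('v \<Rightarrow> 'v \<Rightarrow> bool) \<Rightarrow> nat \<Rightarrow> 'v list \<Rightarrow> 'v set" where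
  "out_ball_path E k Q = (\<Union>x\<in>set Q. out_ball E k x)"

definition in_ball_path :: "('v \<Rightarrow> 'v \<Rightarrow> bool) \<Rightarrow> nat \<Rightarrow> 'v list \<Rightarrow> 'v set" where
  "in_ball_path E k Q = (\<Union>x\<in>set Q. in_ball E k x)"

definition geodesic_side :: "('v \<Rightarrow> 'v \<Rightarrow> bool) \<Rightarrow> 'v \<Rightarrow> 'v \<Rightarrow> 'v list \<Rightarrow> bool" where
  "geodesic_side E x y p \<longleftrightarrow> geodesic E x y p \<or> geodesic E y x p"

definition geodesic_triangle ::
  "('v \<Rightarrow> 'v \<Rightarrow> bool) \<Rightarrow> 'v \<Rightarrow> 'v \<Rightarrow> 'v \<Rightarrow> 'v list \<Rightarrow> 'v list \<Rightarrow> 'v list \<Rightarrow> bool" where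
  "geodesic_triangle E x y z P1 P2 P3 \<longleftrightarrow>
     geodesic_side E x y P1 \<and> geodesic_side E y z P2 \<and> geodesic_side E x z P3"

definition thin_triangle ::
  "('v \<Rightarrow> 'v \<Rightarrow> bool) \<Rightarrow> nat \<Rightarrow> 'v list \<Rightarrow> 'v list \<Rightarrow> 'v list \<Rightarrow> bool" where
  "thin_triangle E \<delta> P1 P2 P3 \<longleftrightarrow>
     (\<forall>P Q R. (P, Q, R) \<in> {(P1,P2,P3), (P1,P3,P2), (P2,P1,P3), (P2,P3,P1), (P3,P1,P2), (P3,P2,P1)} \<longrightarrow>
        (hd P = hd Q \<or> hd P = last Q) \<longrightarrow> (last P = hd R \<or> last P = last R) \<longrightarrow>
        set P \<subseteq> out_ball_path E \<delta> Q \<union> in_ball_path E \<delta> R)"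

definition hyperbolic_digraph :: "('v \<Rightarrow> 'v \<Rightarrow> bool) \<Rightarrow> bool" where
  "hyperbolic_digraph E \<longleftrightarrow>
     (\<exists>\<delta>::nat. \<forall>x y z P1 P2 P3. geodesic_triangle E x y z P1 P2 P3 \<longrightarrow> thin_triangle E \<delta> P1 P2 P3)"

definition fin_gen_set :: "'a::monoid_mult set \<Rightarrow> bool" where
  "fin_gen_set A \<longleftrightarrow> finite A \<and> (\<forall>m::'a. \<exists>w \<in> lists A. prod_list w = m)"

definition cayley_edge :: "'a::monoid_mult set \<Rightarrow> 'a \<Rightarrow> 'a \<Rightarrow> bool" where
  "cayley_edge A m n \<longleftrightarrow> (\<exists>a\<in>A. n = m * a)"

definition hyperbolic_monoid :: "'a::monoid_mult itself \<Rightarrow> bool" where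
  "hyperbolic_monoid _ \<longleftrightarrow> (\<exists>A::'a set. fin_gen_set A \<and> hyperbolic_digraph (cayley_edge A))"

definition right_cancellative :: "'a::monoid_mult itself \<Rightarrow> bool" where
  "right_cancellative _ \<longleftrightarrow> (\<forall>a b c :: 'a. a * c = b * c \<longrightarrow> a = b)"

end

theory Submission
  imports Defs
begin

text \<open>
  Suppose \<open>h\<close> embeds \<open>\<nat> \<times> \<nat>\<close>. Left multiplication never increases distances, and by right
  cancellativity distinct elements of the image move every vertex to distinct vertices and all
  balls of a fixed radius are uniformly finite. Take a long geodesic \<open>P\<close> from some \<open>s\<close> in the
  image to \<open>s * h (n, 0)\<close>, with \<open>s\<close> chosen to minimise this distance; then all translates of
  \<open>P\<close> by the image are again geodesics. For \<open>\<tau>\<close> in a \<open>J \<times> J\<close> box, commutativity bounds the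
  distances between corresponding ends of \<open>P\<close> and \<open>h \<tau> * P\<close> linearly in \<open>J\<close>, so two thin triangles
  place half of the initial \<open>I = O(J)\<close> points of each translate near the first \<open>O(J)\<close> points of
  \<open>P\<close>. These are at least \<open>J\<^sup>2 I / 2\<close> distinct pairs (index, vertex), but there is only room
  for \<open>O(J I)\<close> of them.
\<close>

section \<open>Distances and geodesics in digraphs\<close>

lemma dpath_iff: "dpath E p \<longleftrightarrow> p \<noteq> [] \<and> successively E p"
  by (auto simp: dpath_def successively_conv_nth)

text \<open>\<open>enat\<close> is well-ordered, so the infimum over a nonempty set of paths is
  attained; the empty set gives \<infinity>. A path of length \<open>k\<close> has
  \<open>Suc k\<close> vertices.\<close>

lemma ddist_le_iff:
  "ddist E x y \<le> enat k \<longleftrightarrow> (\<exists>p. dpath_from_to E x y p \<and> length p \<le> Suc k)"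
proof
  assume le: "ddist E x y \<le> enat k"
  let ?S = "(\<lambda>p. enat (length p - 1)) ` {p. dpath_from_to E x y p}"
  have "?S \<noteq> {}"
  proof
    assume "?S = {}"
    then have "ddist E x y = \<infinity>"
      by (simp add: ddist_def top_enat_def)
    with le show False by simp
  qed
  then have "Inf ?S \<in> ?S"
    by (auto intro: wellorder_InfI)
  then obtain p where "dpath_from_to E x y p" "ddist E x y = enat (length p - 1)"
    by (auto simp: ddist_def)
  with le show "\<exists>p. dpath_from_to E x y p \<and> length p \<le> Suc k"
    by force
next
  assume "\<exists>p. dpath_from_to E x y p \<and> length p \<le> Suc k"
  then obtain p where p: "dpath_from_to E x y p" "length p \<le> Suc k" by blast
  then have "ddist E x y \<le> enat (length p - 1)"
    unfolding ddist_def by (intro INF_lower) simp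
  also have "\<dots> \<le> enat k" using p(2) by simp
  finally show "ddist E x y \<le> enat k" .
qed

lemma ddist_le_length: "dpath_from_to E x y p \<Longrightarrow> ddist E x y \<le> enat (length p - 1)"
  unfolding ddist_def by (intro INF_lower) simp

lemma exists_geodesic:
  assumes "ddist E x y \<le> enat k"
  shows "\<exists>p. geodesic E x y p \<and> length p \<le> Suc k"
proof -
  obtain d where d: "ddist E x y = enat d" "d \<le> k"
    using assms by (cases "ddist E x y") auto
  then obtain p where p: "dpath_from_to E x y p" "length p \<le> Suc d"
    using ddist_le_iff[of E x y d] by auto
  have "enat d \<le> enat (length p - 1)"
    using ddist_le_length[OF p(1)] d by simp
  with p have "length p - 1 = d" by simp
  with p d show ?thesis by (auto simp: geodesic_def)
qed

lemma ddist_triangle_le: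
  assumes "ddist E x y \<le> enat k" and "ddist E y z \<le> enat l"
  shows "ddist E x z \<le> enat (k + l)"
proof -
  obtain p q where p: "dpath_from_to E x y p" "length p \<le> Suc k"
    and q: "dpath_from_to E y z q" "length q \<le> Suc l"
    using assms by (auto simp: ddist_le_iff)
  from q obtain q' where q': "q = y # q'"
    by (cases q) (auto simp: dpath_from_to_def dpath_iff)
  have "dpath_from_to E x z (p @ q')"
    using p q unfolding q'
    by (cases q') (auto simp: dpath_from_to_def dpath_iff successively_append_iff)
  moreover have "length (p @ q') \<le> Suc (k + l)"
    using p q q' by simp
  ultimately show ?thesis by (auto simp: ddist_le_iff)
qed

lemma dpath_take:
  assumes "dpath E p" and "n < length p"
  shows "dpath_from_to E (hd p) (p ! n) (take (Suc n) p)"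
proof -
  have "dpath E (take (Suc n) p)" "hd (take (Suc n) p) = hd p"
    using assms by (auto simp: dpath_def)
  moreover have "last (take (Suc n) p) = p ! n"
    using assms by (simp add: take_Suc_conv_app_nth)
  ultimately show ?thesis by (simp add: dpath_from_to_def)
qed

lemma dpath_drop:
  assumes "dpath E p" and "n < length p"
  shows "dpath_from_to E (p ! n) (last p) (drop n p)"
  using assms by (auto simp: dpath_def dpath_from_to_def hd_drop_conv_nth)

lemma geodesicD:
  assumes "geodesic E x y p"
  shows "dpath E p" "p \<noteq> []" "hd p = x" "last p = y" "ddist E x y = enat (length p - 1)"
  using assms by (auto simp: geodesic_def dpath_from_to_def dpath_def)

text \<open>A shorter route to \<open>p ! i\<close>, followed by the rest of \<open>p\<close>, would
  beat the geodesic.\<close>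

lemma geodesic_ddist_nth:
  assumes g: "geodesic E x y p" and i: "i < length p"
  shows "ddist E x (p ! i) = enat i"
proof -
  note p = geodesicD[OF g]
  have "dpath_from_to E x (p ! i) (take (Suc i) p)"
    using dpath_take[OF p(1) i] p(3) by simp
  from ddist_le_length[OF this] i have le: "ddist E x (p ! i) \<le> enat i" by simp
  then obtain j where j: "ddist E x (p ! i) = enat j" "j \<le> i"
    by (cases "ddist E x (p ! i)") auto
  have "dpath_from_to E (p ! i) y (drop i p)"
    using dpath_drop[OF p(1) i] p(4) by simp
  from ddist_le_length[OF this] have "ddist E (p ! i) y \<le> enat (length p - i - 1)" by simp
  from ddist_triangle_le[OF eq_refl[OF j(1)] this]
  have "enat (length p - 1) \<le> enat (j + (length p - i - 1))" by (simp add: p)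
  with i j show ?thesis by simp
qed

lemma geodesic_inj_on_nth: "geodesic E x y p \<Longrightarrow> inj_on ((!) p) {..<length p}"
  by (rule inj_onI) (metis enat.inject geodesic_ddist_nth lessThan_iff)

lemma geodesic_take:
  assumes g: "geodesic E x y p" and i: "i < length p"
  shows "geodesic E x (p ! i) (take (Suc i) p)"
  using dpath_take[OF geodesicD(1)[OF g] i] geodesicD(3)[OF g] i geodesic_ddist_nth[OF g i]
  by (simp add: geodesic_def)

lemma in_out_ball_path: "y \<in> out_ball_path E k Q \<longleftrightarrow> (\<exists>x\<in>set Q. ddist E x y \<le> enat k)"
  by (auto simp: out_ball_path_def out_ball_def)

lemma in_in_ball_path: "y \<in> in_ball_path E k Q \<longleftrightarrow> (\<exists>x\<in>set Q. ddist E y x \<le> enat k)"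
  by (auto simp: in_ball_path_def in_ball_def)

lemma card_UN_le_mult:
  assumes "finite I" and "card I \<le> n" and "\<And>i. i \<in> I \<Longrightarrow> card (X i) \<le> N"
  shows "card (\<Union>i\<in>I. X i) \<le> n * N"
proof -
  have "card (\<Union>i\<in>I. X i) \<le> (\<Sum>i\<in>I. card (X i))"
    by (rule card_UN_le[OF assms(1)])
  also have "\<dots> \<le> card I * N"
    using sum_bounded_above[of I "\<lambda>i. card (X i)" N] assms(3) by simp
  also have "\<dots> \<le> n * N" using assms(2) by simp
  finally show ?thesis .
qed

section \<open>Hyperbolic digraphs with uniformly bounded balls\<close>

text \<open>Radius \<open>2 * \<delta>\<close> arises when two applications of thinness are chained;
  \<open>N\<close> serves all vertices and both kinds of balls.\<close>

locale bounded_thin_digraph =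
  fixes E :: "'v \<Rightarrow> 'v \<Rightarrow> bool" and \<delta> N :: nat
  assumes thin: "geodesic_triangle E x y z P1 P2 P3 \<Longrightarrow> thin_triangle E \<delta> P1 P2 P3"
    and finite_out_ball: "finite (out_ball E (2 * \<delta>) x)"
    and finite_in_ball: "finite (in_ball E (2 * \<delta>) x)"
    and card_out_ball: "card (out_ball E (2 * \<delta>) x) \<le> N"
    and card_in_ball: "card (in_ball E (2 * \<delta>) x) \<le> N"
begin

text \<open>For sides oriented in this way, these are the instances of thinness whose endpoint
  conditions hold automatically.\<close>

lemma transitive_triangle:
  assumes "geodesic E x y P" and "geodesic E y z R" and "geodesic E x z T"
  shows "set P \<subseteq> out_ball_path E \<delta> T \<union> in_ball_path E \<delta> R"
    and "set R \<subseteq> out_ball_path E \<delta> P \<union> in_ball_path E \<delta> T"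
    and "set T \<subseteq> out_ball_path E \<delta> P \<union> in_ball_path E \<delta> R"
proof -
  have "geodesic_triangle E x y z P R T"
    using assms by (simp add: geodesic_triangle_def geodesic_side_def)
  note ends = geodesicD(3,4)[OF assms(1)] geodesicD(3,4)[OF assms(2)] geodesicD(3,4)[OF assms(3)]
  note t = thin[OF \<open>geodesic_triangle E x y z P R T\<close>, unfolded thin_triangle_def, rule_format]
  show "set P \<subseteq> out_ball_path E \<delta> T \<union> in_ball_path E \<delta> R"
    by (rule t) (simp_all add: ends)
  show "set R \<subseteq> out_ball_path E \<delta> P \<union> in_ball_path E \<delta> T"
    by (rule t) (simp_all add: ends)
  show "set T \<subseteq> out_ball_path E \<delta> P \<union> in_ball_path E \<delta> R"
    by (rule t) (simp_all add: ends)
qed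

lemma ball_mono:
  assumes "k \<le> 2 * \<delta>"
  shows "out_ball E k x \<subseteq> out_ball E (2 * \<delta>) x" "in_ball E k x \<subseteq> in_ball E (2 * \<delta>) x"
proof -
  have "enat k \<le> enat (2 * \<delta>)" using assms by simp
  then show "out_ball E k x \<subseteq> out_ball E (2 * \<delta>) x" "in_ball E k x \<subseteq> in_ball E (2 * \<delta>) x"
    unfolding out_ball_def in_ball_def using order_trans by blast+
qed

lemma small_ball:
  assumes "k \<le> 2 * \<delta>"
  shows "finite (out_ball E k x)" "card (out_ball E k x) \<le> N"
    "finite (in_ball E k x)" "card (in_ball E k x) \<le> N"
proof -
  note out = ball_mono(1)[OF assms, of x] and inn = ball_mono(2)[OF assms, of x]
  show "finite (out_ball E k x)" using out finite_out_ball by (rule finite_subset)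
  show "finite (in_ball E k x)" using inn finite_in_ball by (rule finite_subset)
  show "card (out_ball E k x) \<le> N"
    using card_mono[OF finite_out_ball out] card_out_ball by (rule order_trans)
  show "card (in_ball E k x) \<le> N"
    using card_mono[OF finite_in_ball inn] card_in_ball by (rule order_trans)
qed

lemma small_ball_path:
  assumes "k \<le> 2 * \<delta>"
  shows "finite (out_ball_path E k Q)" "card (out_ball_path E k Q) \<le> length Q * N"
    "finite (in_ball_path E k Q)" "card (in_ball_path E k Q) \<le> length Q * N"
  unfolding out_ball_path_def in_ball_path_def
  using small_ball[OF assms] by (auto intro!: card_UN_le_mult card_length)

text \<open>Distances are not symmetric, so a bound on \<open>ddist E x y\<close> does not follow from the
  triangle inequality through \<open>t\<close>; it is obtained by counting vertices in the balls that cover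
  the geodesic.\<close>

lemma geodesic_length_le:
  assumes P: "geodesic E x y P" and yt: "ddist E y t \<le> enat \<delta>" and xt: "ddist E x t \<le> enat m"
  shows "length P \<le> (m + \<delta> + 2) * N"
proof -
  obtain R where R: "geodesic E y t R" "length R \<le> Suc \<delta>"
    using exists_geodesic[OF yt] by blast
  obtain T where T: "geodesic E x t T" "length T \<le> Suc m"
    using exists_geodesic[OF xt] by blast
  have "distinct P"
    using geodesic_inj_on_nth[OF P] by (auto simp: distinct_conv_nth inj_on_def)
  then have "length P = card (set P)" by (simp add: distinct_card)
  also have "\<dots> \<le> card (out_ball_path E \<delta> T \<union> in_ball_path E \<delta> R)"
    using transitive_triangle(1)[OF P R(1) T(1)] by (intro card_mono) (auto simp: small_ball_path)
  also have "\<dots> \<le> length T * N + length R * N"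
    by (rule order_trans[OF card_Un_le]) (simp add: add_mono small_ball_path)
  also have "\<dots> \<le> Suc m * N + Suc \<delta> * N"
    using R T by (intro add_mono mult_le_mono1) auto
  also have "\<dots> = (m + \<delta> + 2) * N" by (simp add: algebra_simps)
  finally show ?thesis .
qed

text \<open>Thinness only yields a common vertex \<open>t\<close> that \<open>p\<close> and the
  given point both reach within \<delta> steps; with directed distances the triangle inequality then
  bounds neither distance between the two.\<close>

definition shadow :: "'v list \<Rightarrow> 'v set" where
  "shadow Q = (\<Union>p\<in>set Q. \<Union>t\<in>out_ball E \<delta> p. in_ball E \<delta> t)"

lemma finite_shadow: "finite (shadow Q)"
  by (auto simp: shadow_def small_ball)

lemma card_shadow: "card (shadow Q) \<le> length Q * (N * N)"
  unfolding shadow_def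
  by (intro card_UN_le_mult) (auto simp: small_ball card_length)

text \<open>Cut the quadrilateral with sides \<open>P\<close>, \<open>P'\<close> and two short sides along the diagonal from
  \<open>e\<close> to \<open>v\<close>: a point of \<open>P'\<close> is close to a short side, which excludes few points, or close to
  the diagonal and then to \<open>P\<close>.\<close>

lemma card_outside_shadow:
  assumes P: "geodesic E e z P" and P': "geodesic E w v P'"
    and ew: "ddist E e w \<le> enat q" and zv: "ddist E z v \<le> enat q"
    and I: "I \<le> length P'"
  shows "card {i. i < I \<and> P' ! i \<notin> shadow (take ((q + I + 2 * \<delta> + 2) * N) P)} \<le> 2 * (Suc q * N)"
proof -
  let ?K = "(q + I + 2 * \<delta> + 2) * N"
  obtain Q where Q: "geodesic E e w Q" "length Q \<le> Suc q"
    using exists_geodesic[OF ew] by blast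
  obtain R where R: "geodesic E z v R" "length R \<le> Suc q"
    using exists_geodesic[OF zv] by blast
  have "ddist E e v \<le> enat (q + (length P' - 1))"
    using ddist_triangle_le[OF ew] geodesicD(5)[OF P'] by simp
  from exists_geodesic[OF this] obtain T where T: "geodesic E e v T" by blast
  have cover: "P' ! i \<in> out_ball_path E \<delta> Q \<union> in_ball_path E (2 * \<delta>) R"
    if i: "i < I" and ns: "P' ! i \<notin> shadow (take ?K P)" for i
  proof (rule ccontr)
    assume far: "P' ! i \<notin> out_ball_path E \<delta> Q \<union> in_ball_path E (2 * \<delta>) R"
    have "P' ! i \<in> set P'" using i I by simp
    then have "P' ! i \<in> in_ball_path E \<delta> T"
      using far transitive_triangle(2)[OF Q(1) P' T] by blast
    then obtain t where t: "t \<in> set T" "ddist E (P' ! i) t \<le> enat \<delta>"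
      by (auto simp: in_in_ball_path)
    have "t \<notin> in_ball_path E \<delta> R"
    proof
      assume "t \<in> in_ball_path E \<delta> R"
      then obtain r where "r \<in> set R" "ddist E t r \<le> enat \<delta>" by (auto simp: in_in_ball_path)
      then have "P' ! i \<in> in_ball_path E (2 * \<delta>) R"
        using ddist_triangle_le[OF t(2)] by (fastforce simp: in_in_ball_path mult_2)
      with far show False by simp
    qed
    then have "t \<in> out_ball_path E \<delta> P"
      using t(1) transitive_triangle(3)[OF P R(1) T] by blast
    then obtain p where p: "p \<in> set P" "ddist E p t \<le> enat \<delta>"
      by (auto simp: in_out_ball_path)
    then obtain k where k: "k < length P" "p = P ! k" by (auto simp: in_set_conv_nth)
    \<comment> \<open>The walk from \<open>e\<close> via \<open>w\<close> and \<open>P' ! i\<close>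
      bounds the distance from \<open>e\<close> to \<open>t\<close>;
      \<open>geodesic_length_le\<close>, applied to the part of \<open>P\<close> ending at
      \<open>p\<close>, turns this into a bound on the index \<open>k\<close>.\<close>
    have "ddist E e (P' ! i) \<le> enat (q + i)"
      using ddist_triangle_le[OF ew] geodesic_ddist_nth[OF P', of i] i I by simp
    then have et: "ddist E e t \<le> enat (q + i + \<delta>)"
      using ddist_triangle_le[OF _ t(2)] by simp
    have "length (take (Suc k) P) \<le> (q + i + \<delta> + \<delta> + 2) * N"
      using geodesic_length_le[OF geodesic_take[OF P k(1)]] p(2) k(2) et by simp
    also have "\<dots> \<le> ?K" using i by (intro mult_le_mono1) simp
    finally have "k < ?K" using k(1) by simp
    then have "p \<in> set (take ?K P)"
      using k by (auto simp: in_set_conv_nth intro!: exI[of _ k])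
    then have "P' ! i \<in> shadow (take ?K P)"
      using p(2) t(2) by (auto simp: shadow_def out_ball_def in_ball_def)
    with ns show False by simp
  qed
  let ?B = "{i. i < I \<and> P' ! i \<notin> shadow (take ?K P)}"
  \<comment> \<open>Vertices of a geodesic are distinct, so the exceptional indices are counted by
    the balls around the two short sides.\<close>
  have "card ?B \<le> card (out_ball_path E \<delta> Q \<union> in_ball_path E (2 * \<delta>) R)"
  proof (rule card_inj_on_le)
    show "inj_on ((!) P') ?B"
      using geodesic_inj_on_nth[OF P'] by (rule inj_on_subset) (use I in auto)
    show "(!) P' ` ?B \<subseteq> out_ball_path E \<delta> Q \<union> in_ball_path E (2 * \<delta>) R"
      using cover by blast
  qed (simp add: small_ball_path)
  also have "\<dots> \<le> length Q * N + length R * N"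
    by (rule order_trans[OF card_Un_le]) (simp add: add_mono small_ball_path)
  also have "\<dots> \<le> Suc q * N + Suc q * N"
    using Q R by (intro add_mono mult_le_mono1) auto
  finally show ?thesis by simp
qed

end

section \<open>Cayley digraphs of right cancellative monoids\<close>

lemma ddist_cayley_word:
  assumes "w \<in> lists A"
  shows "ddist (cayley_edge A) x (x * prod_list w) \<le> enat (length w)"
  using assms
proof (induction w arbitrary: x)
  case Nil
  have "dpath_from_to (cayley_edge A) x x [x]" by (simp add: dpath_from_to_def dpath_def)
  from ddist_le_length[OF this] show ?case by simp
next
  case (Cons a w)
  have "dpath_from_to (cayley_edge A) x (x * a) [x, x * a]"
    using Cons.hyps by (auto simp: dpath_from_to_def dpath_iff cayley_edge_def)
  from ddist_le_length[OF this] have "ddist (cayley_edge A) x (x * a) \<le> enat 1" by simp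
  from ddist_triangle_le[OF this Cons.IH] show ?case by (simp add: mult.assoc)
qed

lemma cayley_path_word:
  "successively (cayley_edge A) p \<Longrightarrow> p \<noteq> [] \<Longrightarrow>
    \<exists>w\<in>lists A. Suc (length w) = length p \<and> last p = hd p * prod_list w"
proof (induction p rule: induct_list012)
  case (2 x)
  then show ?case by (auto intro: bexI[of _ "[]"])
next
  case (3 x y p)
  then obtain w where w: "w \<in> lists A" "Suc (length w) = length (y # p)"
    "last (y # p) = y * prod_list w" by auto
  from 3 obtain a where "a \<in> A" "y = x * a" by (auto simp: cayley_edge_def)
  with w show ?case by (intro bexI[of _ "a # w"]) (auto simp: mult.assoc)
qed simp

lemma ddist_cayley_le_iff:
  "ddist (cayley_edge A) x y \<le> enat k \<longleftrightarrow> (\<exists>w\<in>lists A. length w \<le> k \<and> y = x * prod_list w)"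
proof
  assume "ddist (cayley_edge A) x y \<le> enat k"
  then obtain p where "dpath_from_to (cayley_edge A) x y p" "length p \<le> Suc k"
    by (auto simp: ddist_le_iff)
  then show "\<exists>w\<in>lists A. length w \<le> k \<and> y = x * prod_list w"
    using cayley_path_word[of A p] by (force simp: dpath_from_to_def dpath_iff)
next
  assume "\<exists>w\<in>lists A. length w \<le> k \<and> y = x * prod_list w"
  then obtain w where "w \<in> lists A" "length w \<le> k" "y = x * prod_list w" by blast
  then show "ddist (cayley_edge A) x y \<le> enat k"
    using ddist_cayley_word[of w A x] by (auto intro: order_trans)
qed

lemma ddist_cayley_mult_le:
  "ddist (cayley_edge A) x y \<le> enat k \<Longrightarrow> ddist (cayley_edge A) (m * x) (m * y) \<le> enat k"
  by (auto simp: ddist_cayley_le_iff mult.assoc)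

text \<open>Translated paths keep their length, but distances may shrink; hence the assumption
  \<open>d\<close>.\<close>

lemma geodesic_map_mult:
  assumes P: "geodesic (cayley_edge A) x y P"
    and d: "ddist (cayley_edge A) (m * x) (m * y) = ddist (cayley_edge A) x y"
  shows "geodesic (cayley_edge A) (m * x) (m * y) (map ((*) m) P)"
proof -
  have "successively (\<lambda>u v. cayley_edge A (m * u) (m * v)) P"
    using geodesicD(1)[OF P]
    by (auto simp: dpath_iff cayley_edge_def mult.assoc intro: successively_mono)
  then show ?thesis
    using geodesicD[OF P] d
    by (auto simp: geodesic_def dpath_from_to_def dpath_iff successively_map hd_map last_map)
qed

lemma cayley_balls_bounded:
  fixes A :: "'a::monoid_mult set"
  assumes rc: "right_cancellative TYPE('a)" and "finite A"
  shows "\<exists>N. \<forall>x. finite (out_ball (cayley_edge A) k x) \<and> card (out_ball (cayley_edge A) k x) \<le> N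
    \<and> finite (in_ball (cayley_edge A) k x) \<and> card (in_ball (cayley_edge A) k x) \<le> N"
proof -
  let ?W = "{w. set w \<subseteq> A \<and> length w \<le> k}"
  have fin: "finite ?W" using \<open>finite A\<close> by (rule finite_lists_length_le)
  have "finite (out_ball (cayley_edge A) k x) \<and> card (out_ball (cayley_edge A) k x) \<le> card ?W
    \<and> finite (in_ball (cayley_edge A) k x) \<and> card (in_ball (cayley_edge A) k x) \<le> card ?W" for x
  proof -
    have out: "out_ball (cayley_edge A) k x \<subseteq> (\<lambda>w. x * prod_list w) ` ?W"
      by (auto simp: out_ball_def ddist_cayley_le_iff in_lists_conv_set)
    have "\<forall>y\<in>in_ball (cayley_edge A) k x. \<exists>w. w \<in> ?W \<and> x = y * prod_list w"
      by (auto simp: in_ball_def ddist_cayley_le_iff in_lists_conv_set)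
    then obtain f where f: "\<And>y. y \<in> in_ball (cayley_edge A) k x \<Longrightarrow>
        f y \<in> ?W \<and> x = y * prod_list (f y)"
      by metis
    \<comment> \<open>If \<open>y\<close> and \<open>y'\<close> get the same word \<open>w\<close>,
      then \<open>y * prod_list w = x = y' * prod_list w\<close>, and right cancellation gives
      \<open>y = y'\<close>.\<close>
    have inj: "inj_on f (in_ball (cayley_edge A) k x)"
      using f rc unfolding right_cancellative_def inj_on_def by metis
    have sub: "f ` in_ball (cayley_edge A) k x \<subseteq> ?W" using f by blast
    show ?thesis
      using finite_surj[OF fin out] surj_card_le[OF fin out] inj_on_finite[OF inj sub fin]
        card_inj_on_le[OF inj sub fin] by blast
  qed
  then show ?thesis by blast
qed

text \<open>Ensures that even the shortest displacement by a suitable \<open>h (n, 0)\<close>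
  exceeds \<open>L\<close>. Otherwise left multiplication carries short displacements for
  \<open>n = 0, ..., M\<close> to one common base point, whose ball of radius \<open>L\<close> would
  contain \<open>M + 1\<close> distinct points, although such balls have at most
  \<open>M\<close>.\<close>

lemma range_displacement_unbounded:
  fixes h :: "nat \<times> nat \<Rightarrow> 'a::monoid_mult"
  assumes rc: "right_cancellative TYPE('a)" and fin: "finite A" and inj: "inj h"
    and hom: "\<And>i j k l. h (i + k, j + l) = h (i, j) * h (k, l)"
  shows "\<exists>n. \<forall>\<sigma>. \<not> ddist (cayley_edge A) (h \<sigma>) (h \<sigma> * h (n, 0)) \<le> enat L"
proof (rule ccontr)
  assume "\<nexists>n. \<forall>\<sigma>. \<not> ddist (cayley_edge A) (h \<sigma>) (h \<sigma> * h (n, 0)) \<le> enat L"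
  then obtain \<sigma> where \<sigma>: "\<And>n. ddist (cayley_edge A) (h (\<sigma> n)) (h (\<sigma> n) * h (n, 0)) \<le> enat L"
    by metis
  obtain M where M: "\<And>x. finite (out_ball (cayley_edge A) L x)"
    "\<And>x. card (out_ball (cayley_edge A) L x) \<le> M"
    using cayley_balls_bounded[OF rc fin] by blast
  \<comment> \<open>A sum of naturals dominates each term, so \<open>(X, Y)\<close> arises from
    every \<open>\<sigma> n\<close> with \<open>n \<le> M\<close> by adding a pair of
    naturals.\<close>
  define X where "X = (\<Sum>n\<le>M. fst (\<sigma> n))"
  define Y where "Y = (\<Sum>n\<le>M. snd (\<sigma> n))"
  let ?f = "\<lambda>n. h (X, Y) * h (n, 0)"
  have "?f n \<in> out_ball (cayley_edge A) L (h (X, Y))" if "n \<le> M" for n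
  proof -
    have "fst (\<sigma> n) \<le> X" "snd (\<sigma> n) \<le> Y"
      unfolding X_def Y_def using that by (auto intro!: member_le_sum)
    then have "h (X, Y) = h (X - fst (\<sigma> n), Y - snd (\<sigma> n)) * h (\<sigma> n)"
      using hom[of "X - fst (\<sigma> n)" "fst (\<sigma> n)" "Y - snd (\<sigma> n)" "snd (\<sigma> n)"] by simp
    then show ?thesis
      using ddist_cayley_mult_le[OF \<sigma>[of n]] by (simp add: out_ball_def mult.assoc)
  qed
  then have "?f ` {..M} \<subseteq> out_ball (cayley_edge A) L (h (X, Y))" by blast
  moreover have "inj_on ?f {..M}"
    by (auto intro!: inj_onI simp: hom[symmetric] dest!: injD[OF inj])
  ultimately have "card {..M} \<le> card (out_ball (cayley_edge A) L (h (X, Y)))"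
    using M(1) by (metis card_inj_on_le)
  also have "\<dots> \<le> M" by (rule M(2))
  finally show False by simp
qed

section \<open>Counting translates of a minimal geodesic\<close>

theorem theorem4p3:
  assumes "right_cancellative TYPE('a::monoid_mult)"
    and "hyperbolic_monoid TYPE('a)"
  shows "\<not> (\<exists>h :: nat \<times> nat \<Rightarrow> 'a. inj h \<and> h (0, 0) = 1 \<and>
            (\<forall>i j k l. h (i + k, j + l) = h (i, j) * h (k, l)))"
proof
  assume "\<exists>h :: nat \<times> nat \<Rightarrow> 'a. inj h \<and> h (0, 0) = 1 \<and>
            (\<forall>i j k l. h (i + k, j + l) = h (i, j) * h (k, l))"
  then obtain h :: "nat \<times> nat \<Rightarrow> 'a" where inj: "inj h" and one: "h (0, 0) = 1"
    and hom: "\<And>i j k l. h (i + k, j + l) = h (i, j) * h (k, l)"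
    by blast
  have cancel: "x = y" if "x * c = y * c" for x y c :: 'a
    using assms(1) that unfolding right_cancellative_def by blast
  have comm: "h \<sigma> * h \<tau> = h \<tau> * h \<sigma>" for \<sigma> \<tau>
    by (cases \<sigma>; cases \<tau>) (simp add: hom[symmetric] add.commute)
  obtain A :: "'a set" and \<delta> where A: "fin_gen_set A"
    and thin: "\<And>x y z P1 P2 P3. geodesic_triangle (cayley_edge A) x y z P1 P2 P3 \<Longrightarrow>
      thin_triangle (cayley_edge A) \<delta> P1 P2 P3"
    using assms(2) unfolding hyperbolic_monoid_def hyperbolic_digraph_def by blast
  have fin: "finite A" using A by (simp add: fin_gen_set_def)
  obtain N0 where N0: "\<forall>x. finite (out_ball (cayley_edge A) (2 * \<delta>) x) \<and>
      card (out_ball (cayley_edge A) (2 * \<delta>) x) \<le> N0 \<and>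
      finite (in_ball (cayley_edge A) (2 * \<delta>) x) \<and>
      card (in_ball (cayley_edge A) (2 * \<delta>) x) \<le> N0"
    using cayley_balls_bounded[OF assms(1) fin] by blast
  \<comment> \<open>The successor makes \<open>N\<close> positive, so that
    \<open>2 * (Suc q * N)\<close> can be cancelled at the end.\<close>
  define N where "N = Suc N0"
  interpret bounded_thin_digraph "cayley_edge A" \<delta> N
    using thin N0 by unfold_locales (auto simp: N_def le_SucI)
  let ?d = "ddist (cayley_edge A)"
  have short: "\<exists>c. \<forall>x. ?d x (x * m) \<le> enat c" for m
  proof -
    obtain w where "w \<in> lists A" "prod_list w = m" using A by (auto simp: fin_gen_set_def)
    then show ?thesis using ddist_cayley_word by blast
  qed
  obtain c1 c2 where c1: "\<And>x. ?d x (x * h (1, 0)) \<le> enat c1"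
    and c2: "\<And>x. ?d x (x * h (0, 1)) \<le> enat c2"
    using short by metis
  define c where "c = c1 + c2"
  have row: "?d x (x * h (i, 0)) \<le> enat (i * c)" for x i
  proof (induction i)
    case 0
    show ?case using ddist_cayley_word[of "[]" A x] by (simp add: one)
  next
    case (Suc i)
    have "?d (x * h (i, 0)) (x * h (i, 0) * h (1, 0)) \<le> enat c"
      using c1 by (rule order_trans) (simp add: c_def)
    from ddist_triangle_le[OF Suc this] show ?case
      using hom[of i 1 0 0] by (simp add: mult.assoc add.commute)
  qed
  have col: "?d x (x * h (0, j)) \<le> enat (j * c)" for x j
  proof (induction j)
    case 0
    show ?case using ddist_cayley_word[of "[]" A x] by (simp add: one)
  next
    case (Suc j)
    have "?d (x * h (0, j)) (x * h (0, j) * h (0, 1)) \<le> enat c"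
      using c2 by (rule order_trans) (simp add: c_def)
    from ddist_triangle_le[OF Suc this] show ?case
      using hom[of 0 0 j 1] by (simp add: mult.assoc add.commute)
  qed
  \<comment> \<open>\<open>q\<close> bounds displacements by box elements, \<open>I\<close> is twice
    the number of exceptional indices allowed by \<open>card_outside_shadow\<close>, and
    \<open>K\<close> is the prefix length used there. \<open>D\<close> is chosen so that
    \<open>2 * K * (N * N) \<le> D * J\<close>, while \<open>J\<close> exceeds
    \<open>D\<close>.\<close>
  define D where "D = 2 * (N * N * N) * (2 * c * (1 + 4 * N) + 4 * N + 2 * \<delta> + 2)"
  define J where "J = Suc D"
  define q where "q = 2 * c * J"
  define I where "I = 4 * (Suc q * N)"
  define K where "K = (q + I + 2 * \<delta> + 2) * N"
  define Box where "Box = {..<J} \<times> {..<J}"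
  have box: "?d x (x * h \<sigma>) \<le> enat q" if "\<sigma> \<in> Box" for x \<sigma>
  proof -
    obtain i j where ij: "\<sigma> = (i, j)" "i \<le> J" "j \<le> J"
      using \<open>\<sigma> \<in> Box\<close> by (auto simp: Box_def)
    have "?d x (x * h \<sigma>) \<le> enat (i * c + j * c)"
      using ddist_triangle_le[OF row col] hom[of i 0 0 j] ij by (simp add: mult.assoc)
    also have "enat (i * c + j * c) \<le> enat q"
      using add_mono[OF mult_le_mono1[OF ij(2), of c] mult_le_mono1[OF ij(3), of c]]
      by (simp add: q_def algebra_simps flip: mult_2)
    finally show ?thesis .
  qed
  obtain n where n: "\<And>\<sigma>. \<not> ?d (h \<sigma>) (h \<sigma> * h (n, 0)) \<le> enat I"
    using range_displacement_unbounded[OF assms(1) fin inj hom] by blast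
  \<comment> \<open>Well-ordering of \<open>enat\<close> provides a base point where the
    displacement is minimal.\<close>
  have "Inf (range (\<lambda>\<sigma>. ?d (h \<sigma>) (h \<sigma> * h (n, 0)))) \<in> range (\<lambda>\<sigma>. ?d (h \<sigma>) (h \<sigma> * h (n, 0)))"
    by (rule wellorder_InfI) blast
  then obtain \<sigma> where \<sigma>: "?d (h \<sigma>) (h \<sigma> * h (n, 0)) = (INF \<sigma>. ?d (h \<sigma>) (h \<sigma> * h (n, 0)))"
    by auto
  have minimal: "?d (h \<sigma>) (h \<sigma> * h (n, 0)) \<le> ?d (h \<tau>) (h \<tau> * h (n, 0))" for \<tau>
    by (rule ord_eq_le_trans[OF \<sigma> INF_lower]) simp
  define s where "s = h \<sigma>"
  define z where "z = s * h (n, 0)"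
  \<comment> \<open>Commuting turns the displacement from \<open>s\<close> to
    \<open>s * h \<tau>\<close>, which \<open>box\<close> bounds, into the distance from
    \<open>s\<close> to the start of the translated geodesic. The end \<open>z\<close> also lies in
    the image of \<open>h\<close> and is treated likewise.\<close>
  have s_comm: "s * h \<tau> = h \<tau> * s" for \<tau>
    unfolding s_def by (rule comm)
  have "z = h (fst \<sigma> + n, snd \<sigma>)"
    using hom[of "fst \<sigma>" n "snd \<sigma>" 0] by (simp add: z_def s_def)
  then have z_comm: "z * h \<tau> = h \<tau> * z" for \<tau>
    using comm by simp
  obtain P where P: "geodesic (cayley_edge A) s z P"
    using exists_geodesic[OF row] unfolding z_def by blast
  have "\<not> enat (length P - 1) \<le> enat I"
    using n[of \<sigma>] geodesicD(5)[OF P] by (simp add: s_def z_def)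
  then have I_le: "I \<le> length P" by simp
  \<comment> \<open>Left multiplication cannot lengthen the distance, and minimality forbids
    shortening it because \<open>h \<tau> * s\<close> is again in the image of
    \<open>h\<close>.\<close>
  have translate: "geodesic (cayley_edge A) (h \<tau> * s) (h \<tau> * z) (map ((*) (h \<tau>)) P)" for \<tau>
  proof (rule geodesic_map_mult[OF P], rule antisym)
    show "?d (h \<tau> * s) (h \<tau> * z) \<le> ?d s z"
      using ddist_cayley_mult_le[of A s z _ "h \<tau>"] geodesicD(5)[OF P] by simp
    have "h \<tau> * s = h (fst \<tau> + fst \<sigma>, snd \<tau> + snd \<sigma>)"
      by (simp add: hom s_def)
    then show "?d s z \<le> ?d (h \<tau> * s) (h \<tau> * z)"
      using minimal by (simp add: s_def z_def mult.assoc[symmetric])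
  qed
  let ?Y = "shadow (take K P)"
  let ?G = "\<lambda>\<tau>. {i. i < I \<and> h \<tau> * P ! i \<in> ?Y}"
  have good: "2 * (Suc q * N) \<le> card (?G \<tau>)" if "\<tau> \<in> Box" for \<tau>
  proof -
    let ?P = "map ((*) (h \<tau>)) P"
    have sw: "?d s (h \<tau> * s) \<le> enat q"
      using box[OF that, of s] by (simp add: s_comm)
    have zw: "?d z (h \<tau> * z) \<le> enat q"
      using box[OF that, of z] by (simp add: z_comm)
    have "card {i. i < I \<and> ?P ! i \<notin> ?Y} \<le> 2 * (Suc q * N)"
      using card_outside_shadow[OF P translate sw zw, of I] I_le by (simp add: K_def)
    moreover have "{i. i < I \<and> ?P ! i \<notin> ?Y} = {i. i < I \<and> h \<tau> * P ! i \<notin> ?Y}"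
      using I_le by auto
    moreover have "card (?G \<tau>) + card {i. i < I \<and> h \<tau> * P ! i \<notin> ?Y} = I"
    proof -
      have "{..<I} = ?G \<tau> \<union> {i. i < I \<and> h \<tau> * P ! i \<notin> ?Y}" by auto
      then have "I = card (?G \<tau> \<union> {i. i < I \<and> h \<tau> * P ! i \<notin> ?Y})"
        by (metis card_lessThan)
      also have "\<dots> = card (?G \<tau>) + card {i. i < I \<and> h \<tau> * P ! i \<notin> ?Y}"
        by (rule card_Un_disjoint) auto
      finally show ?thesis by simp
    qed
    ultimately show ?thesis by (simp add: I_def)
  qed
  \<comment> \<open>Pairs of a box element and a good index are counted from below by
    \<open>good\<close> and from above through indices and shadow vertices.\<close>
  have "J * J * (2 * (Suc q * N)) = (\<Sum>\<tau>\<in>Box. 2 * (Suc q * N))"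
    by (simp add: Box_def)
  also have "\<dots> \<le> (\<Sum>\<tau>\<in>Box. card (?G \<tau>))"
    by (rule sum_mono) (rule good)
  also have "\<dots> = card (SIGMA \<tau>:Box. ?G \<tau>)"
    by (subst card_SigmaI) (auto simp: Box_def)
  also have "\<dots> \<le> card ({..<I} \<times> ?Y)"
  proof (rule card_inj_on_le)
    \<comment> \<open>The image pair shows \<open>i\<close>; right cancellation of
      \<open>P ! i\<close> then recovers \<open>h \<tau>\<close>, and injectivity of
      \<open>h\<close> recovers \<tau>.\<close>
    show "inj_on (\<lambda>(\<tau>, i). (i, h \<tau> * P ! i)) (SIGMA \<tau>:Box. ?G \<tau>)"
      using inj by (auto simp: inj_on_def dest!: cancel)
  qed (auto simp: finite_shadow)
  also have "\<dots> \<le> I * (K * (N * N))"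
  proof -
    have "card ?Y \<le> K * (N * N)"
      using card_shadow[of "take K P"] by (rule order_trans) (intro mult_le_mono1, simp)
    then show ?thesis by (simp add: card_cartesian_product)
  qed
  finally have "2 * (Suc q * N) * (J * J) \<le> 2 * (Suc q * N) * (2 * K * (N * N))"
    by (simp only: I_def ac_simps)
  moreover have "0 < 2 * (Suc q * N)" by (simp add: N_def)
  ultimately have "J * J \<le> 2 * K * (N * N)"
    by (metis mult_le_cancel1)
  \<comment> \<open>\<open>q + I\<close> is affine in \<open>J\<close>; since \<open>J\<close> is at
    least 1, the constant terms are absorbed into multiples of \<open>J\<close>.\<close>
  also have "\<dots> \<le> D * J"
  proof -
    have "q + I + 2 * \<delta> + 2 = 2 * c * (1 + 4 * N) * J + (4 * N + 2 * \<delta> + 2)"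
      by (simp add: q_def I_def algebra_simps)
    also have "\<dots> \<le> 2 * c * (1 + 4 * N) * J + (4 * N + 2 * \<delta> + 2) * J"
      by (intro add_left_mono) (simp add: J_def)
    finally have "K \<le> ((2 * c * (1 + 4 * N) + (4 * N + 2 * \<delta> + 2)) * J) * N"
      unfolding K_def by (intro mult_le_mono1) (simp add: algebra_simps)
    then have "2 * (N * N) * K \<le> 2 * (N * N) * (((2 * c * (1 + 4 * N) + (4 * N + 2 * \<delta> + 2)) * J) * N)"
      by (rule mult_le_mono2)
    then show ?thesis by (simp add: D_def algebra_simps)
  qed
  finally show False by (simp add: J_def)
qed

end
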